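(* Let $V$ be a superspace over a field $\mathbb{F}$, and let $a\in V_{\bar 0}$. The superalgebra $(\mathcal{U}(V),\bigtriangleup_a)$ is conservative, and the associated multiplication can be given by $$(A\bigtriangledown^1_a B)(x,y)=-(-1)^{|A||B|}B(a,A(x,y)),$$ or (if $\operatorname{char}\mathbb{F}\neq3$) by $$A\bigtriangledown^2_a B=\tfrac13\big(A^*\bigtriangleup_a B+(-1)^{|A||B|}\tilde B\bigtriangleup_a A\big),$$ where $A^*(x,y)=A(x,y)+(-1)^{|x||y|}A(y,x)$ and $\tilde B(x,y)=2(-1)^{|x||y|}B(y,x)-B(x,y)$.
   Context: A superspace is a $\mathbb{Z}_2$-graded space $V=V_{\bar0}\oplus V_{\bar1}$ over $\mathbb{F}$, and $|x|$ denotes the parity of a homogeneous $x$. Formulas with signs are stated for homogeneous elements and extended by linearity. $\mathcal{U}(V)$ is the superspace of all bilinear operations $V\times V\to V$; an operation $B$ has parity $|B|$ if $B(V_{\bar i},V_{\bar j})\subseteq V_{\overline{i+j+|B|}}$. For $a\in V_{\bar0}$ the product $\bigtriangleup_a$ on $\mathcal{U}(V)$ is $$(A\bigtriangleup_a B)(x,y)=A(a,B(x,y))-(-1)^{|A||B|}B(A(a,x),y)-(-1)^{|A|(|B|+|x|)}B(x,A(a,y)).$$ For a linear operator $A$ and a bilinear operation $B$ on a superspace $U$ put $$[A,B](x,y)=A(B(x,y))-(-1)^{|A||B|}B(A(x),y)-(-1)^{|A|(|B|+|x|)}B(x,A(y)).$$ A superalgebra on a superspace $U$ with even multiplication $M(x,y)=xy$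 (not assumed associative, commutative or unital), with $L_x(y)=xy$, is called conservative if there is an even bilinear operation $x*y$ on $U$ (an associated multiplication) such that $[L_y,[L_x,M]]=-(-1)^{|x||y|}[L_{x*y},M]$ for all homogeneous $x,y\in U$. In the claim this is applied with $U=\mathcal{U}(V)$ and $M=\bigtriangleup_a$. *)

theory Defs
  imports
    Complex_Main
    "HOL-Library.Z2"
    "HOL-Library.Function_Algebras"
begin

section \<open>Superspaces\<close>

text \<open>A superspace is given by its scalar multiplication, its carrier \<open>S\<close> and its grading \<open>G\<close> by
  the field \<^typ>\<open>bit\<close> of two elements. The carrier need not be a whole type, because
  the space of all bilinear operations is only a subset of a function type.\<close>

definition superspace ::
    "('f::field \<Rightarrow> 'a::ab_group_add \<Rightarrow> 'a) \<Rightarrow> 'a set \<Rightarrow> (bit \<Rightarrow> 'a set) \<Rightarrow> bool" where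
  "superspace sc S G \<longleftrightarrow>
     vector_space sc \<and> module.subspace sc S \<and> (\<forall>p. module.subspace sc (G p)) \<and>
     S = {x + y | x y. x \<in> G 0 \<and> y \<in> G 1} \<and> G 0 \<inter> G 1 = {0}"

definition signed :: "bit \<Rightarrow> 'a::ab_group_add \<Rightarrow> 'a" where
  \<comment> \<open>\<open>signed p x\<close> is \<open>(-1)\<^sup>p x\<close>\<close>
  "signed p x = (if p = 0 then x else - x)"

definition hcomp :: "(bit \<Rightarrow> 'a::ab_group_add set) \<Rightarrow> bit \<Rightarrow> 'a \<Rightarrow> 'a" where
  \<comment> \<open>the homogeneous component of \<open>x\<close> of parity \<open>p\<close>; meaningful for \<open>x\<close> in the carrier\<close>
  "hcomp G p x = (THE y. y \<in> G p \<and> x - y \<in> G (p + 1))"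

definition hext :: "(bit \<Rightarrow> 'a::ab_group_add set) \<Rightarrow> (bit \<Rightarrow> 'a \<Rightarrow> 'b) \<Rightarrow> 'a \<Rightarrow> 'b::ab_group_add" where
  \<comment> \<open>extension by linearity of a formula \<open>f p x\<close> stated for homogeneous \<open>x\<close> of parity \<open>p\<close>\<close>
  "hext G f x = f 0 (hcomp G 0 x) + f 1 (hcomp G 1 x)"

section \<open>Bilinear operations\<close>

definition bilinear_op ::
    "('f::field \<Rightarrow> 'a::ab_group_add \<Rightarrow> 'a) \<Rightarrow> 'a set \<Rightarrow> ('a \<Rightarrow> 'a \<Rightarrow> 'a) \<Rightarrow> bool" where
  "bilinear_op sc S B \<longleftrightarrow>
     (\<forall>x\<in>S. \<forall>y\<in>S. B x y \<in> S) \<and>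
     (\<forall>x\<in>S. \<forall>x'\<in>S. \<forall>y\<in>S. B (x + x') y = B x y + B x' y) \<and>
     (\<forall>x\<in>S. \<forall>y\<in>S. \<forall>y'\<in>S. B x (y + y') = B x y + B x y') \<and>
     (\<forall>c. \<forall>x\<in>S. \<forall>y\<in>S. B (sc c x) y = sc c (B x y) \<and> B x (sc c y) = sc c (B x y))"

definition has_parity :: "(bit \<Rightarrow> 'a set) \<Rightarrow> bit \<Rightarrow> ('a \<Rightarrow> 'a \<Rightarrow> 'a) \<Rightarrow> bool" where
  "has_parity G p B \<longleftrightarrow> (\<forall>i j. \<forall>x\<in>G i. \<forall>y\<in>G j. B x y \<in> G (i + j + p))"

definition op_scale :: "('f \<Rightarrow> 'a \<Rightarrow> 'a) \<Rightarrow> 'f \<Rightarrow> ('a \<Rightarrow> 'a \<Rightarrow> 'a) \<Rightarrow> 'a \<Rightarrow> 'a \<Rightarrow> 'a" where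
  "op_scale sc c B = (\<lambda>x y. sc c (B x y))"

text \<open>The superspace of all bilinear operations on a superspace whose carrier is the whole type,
  with pointwise addition.\<close>

definition ops :: "('f::field \<Rightarrow> 'a::ab_group_add \<Rightarrow> 'a) \<Rightarrow> ('a \<Rightarrow> 'a \<Rightarrow> 'a) set" where
  "ops sc = {B. bilinear_op sc UNIV B}"

definition ops_gr ::
    "('f::field \<Rightarrow> 'a::ab_group_add \<Rightarrow> 'a) \<Rightarrow> (bit \<Rightarrow> 'a set) \<Rightarrow> bit \<Rightarrow> ('a \<Rightarrow> 'a \<Rightarrow> 'a) set" where
  "ops_gr sc V p = {B \<in> ops sc. has_parity V p B}"

section \<open>Conservative superalgebras\<close>

definition superalgebra ::
    "('f::field \<Rightarrow> 'a::ab_group_add \<Rightarrow> 'a) \<Rightarrow> 'a set \<Rightarrow> (bit \<Rightarrow> 'a set) \<Rightarrow> ('a \<Rightarrow> 'a \<Rightarrow> 'a) \<Rightarrow> bool" where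
  "superalgebra sc S G M \<longleftrightarrow> superspace sc S G \<and> bilinear_op sc S M \<and> has_parity G 0 M"

text \<open>The bracket of a linear operator \<open>A\<close> of parity \<open>p\<close> with a bilinear operation \<open>B\<close> of parity \<open>q\<close>.
  The parities are arguments, since the bracket is only taken of homogeneous \<open>A\<close> and \<open>B\<close>.\<close>

definition bracket ::
    "(bit \<Rightarrow> 'a::ab_group_add set) \<Rightarrow> bit \<Rightarrow> bit \<Rightarrow> ('a \<Rightarrow> 'a) \<Rightarrow> ('a \<Rightarrow> 'a \<Rightarrow> 'a) \<Rightarrow> 'a \<Rightarrow> 'a \<Rightarrow> 'a" where
  "bracket G p q A B x y =
     hext G (\<lambda>i x. A (B x y) - signed (p * q) (B (A x) y) - signed (p * (q + i)) (B x (A y))) x"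

text \<open>Left multiplication by \<open>x\<close> is \<open>M x\<close>. It has the parity of \<open>x\<close>, and so does its bracket with
  the even operation \<open>M\<close>. Equality of operations is equality on the carrier.\<close>

definition associated_mult ::
    "('f::field \<Rightarrow> 'a::ab_group_add \<Rightarrow> 'a) \<Rightarrow> 'a set \<Rightarrow> (bit \<Rightarrow> 'a set) \<Rightarrow>
     ('a \<Rightarrow> 'a \<Rightarrow> 'a) \<Rightarrow> ('a \<Rightarrow> 'a \<Rightarrow> 'a) \<Rightarrow> bool" where
  "associated_mult sc S G M st \<longleftrightarrow>
     bilinear_op sc S st \<and> has_parity G 0 st \<and>
     (\<forall>i j. \<forall>x\<in>G i. \<forall>y\<in>G j. \<forall>u\<in>S. \<forall>v\<in>S.
        bracket G j i (M y) (bracket G i 0 (M x) M) u v =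
        - signed (i * j) (bracket G (i + j) 0 (M (st x y)) M u v))"

definition conservative ::
    "('f::field \<Rightarrow> 'a::ab_group_add \<Rightarrow> 'a) \<Rightarrow> 'a set \<Rightarrow> (bit \<Rightarrow> 'a set) \<Rightarrow> ('a \<Rightarrow> 'a \<Rightarrow> 'a) \<Rightarrow> bool" where
  "conservative sc S G M \<longleftrightarrow> superalgebra sc S G M \<and> (\<exists>st. associated_mult sc S G M st)"

section \<open>The operations on the space of bilinear operations\<close>

definition tri ::
    "('f::field \<Rightarrow> 'a::ab_group_add \<Rightarrow> 'a) \<Rightarrow> (bit \<Rightarrow> 'a set) \<Rightarrow> 'a \<Rightarrow>
     ('a \<Rightarrow> 'a \<Rightarrow> 'a) \<Rightarrow> ('a \<Rightarrow> 'a \<Rightarrow> 'a) \<Rightarrow> 'a \<Rightarrow> 'a \<Rightarrow> 'a" where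
  "tri sc V a A B =
     hext (ops_gr sc V) (\<lambda>p A. hext (ops_gr sc V) (\<lambda>q B.
       (\<lambda>x y. hext V (\<lambda>i x.
          A a (B x y) - signed (p * q) (B (A a x) y) - signed (p * (q + i)) (B x (A a y))) x)) B) A"

definition nabla1 ::
    "('f::field \<Rightarrow> 'a::ab_group_add \<Rightarrow> 'a) \<Rightarrow> (bit \<Rightarrow> 'a set) \<Rightarrow> 'a \<Rightarrow>
     ('a \<Rightarrow> 'a \<Rightarrow> 'a) \<Rightarrow> ('a \<Rightarrow> 'a \<Rightarrow> 'a) \<Rightarrow> 'a \<Rightarrow> 'a \<Rightarrow> 'a" where
  "nabla1 sc V a A B =
     hext (ops_gr sc V) (\<lambda>p A. hext (ops_gr sc V) (\<lambda>q B.
       (\<lambda>x y. - signed (p * q) (B a (A x y)))) B) A"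

definition op_star ::
    "(bit \<Rightarrow> 'a::ab_group_add set) \<Rightarrow> ('a \<Rightarrow> 'a \<Rightarrow> 'a) \<Rightarrow> 'a \<Rightarrow> 'a \<Rightarrow> 'a" where
  "op_star V A x y = hext V (\<lambda>i x. hext V (\<lambda>j y. A x y + signed (i * j) (A y x)) y) x"

definition op_tilde ::
    "('f::field \<Rightarrow> 'a::ab_group_add \<Rightarrow> 'a) \<Rightarrow> (bit \<Rightarrow> 'a set) \<Rightarrow>
     ('a \<Rightarrow> 'a \<Rightarrow> 'a) \<Rightarrow> 'a \<Rightarrow> 'a \<Rightarrow> 'a" where
  "op_tilde sc V B x y =
     hext V (\<lambda>i x. hext V (\<lambda>j y. sc 2 (signed (i * j) (B y x)) - B x y) y) x"

definition nabla2 ::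
    "('f::field \<Rightarrow> 'a::ab_group_add \<Rightarrow> 'a) \<Rightarrow> (bit \<Rightarrow> 'a set) \<Rightarrow> 'a \<Rightarrow>
     ('a \<Rightarrow> 'a \<Rightarrow> 'a) \<Rightarrow> ('a \<Rightarrow> 'a \<Rightarrow> 'a) \<Rightarrow> 'a \<Rightarrow> 'a \<Rightarrow> 'a" where
  "nabla2 sc V a A B =
     hext (ops_gr sc V) (\<lambda>p A. hext (ops_gr sc V) (\<lambda>q B.
       op_scale sc (1 / 3)
         (tri sc V a (op_star V A) B + signed (p * q) (tri sc V a (op_tilde sc V B) A))) B) A"

section \<open>The formulas on homogeneous elements\<close>

lemma hcomp_eqI:
  assumes "superspace sc S G" and y: "y \<in> G p" "x - y \<in> G (p + 1)"
  shows "hcomp G p x = y"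
  unfolding hcomp_def
proof (rule the_equality)
  interpret vector_space sc using assms(1) by (simp add: superspace_def)
  have sub: "subspace (G q)" for q using assms(1) by (simp add: superspace_def)
  have int: "G 0 \<inter> G 1 = {0}" using assms(1) by (simp add: superspace_def)
  show "y \<in> G p \<and> x - y \<in> G (p + 1)" using y by simp
  fix w assume w: "w \<in> G p \<and> x - w \<in> G (p + 1)"
  have "w - y \<in> G p" using w y subspace_diff[OF sub] by blast
  moreover have "(x - y) - (x - w) \<in> G (p + 1)" using w y subspace_diff[OF sub] by blast
  ultimately have "w - y \<in> G 0 \<inter> G 1" by (cases p) simp_all
  then show "w = y" using int by simp
qed

lemma hcomp_homogeneous:
  assumes "superspace sc S G" and "x \<in> G p"
  shows "hcomp G p x = x" and "hcomp G (p + 1) x = 0"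
proof -
  interpret vector_space sc using assms(1) by (simp add: superspace_def)
  have "0 \<in> G q" for q using assms(1) subspace_0 by (auto simp: superspace_def)
  then show "hcomp G p x = x" "hcomp G (p + 1) x = 0"
    by (rule_tac [!] hcomp_eqI[OF assms(1)]) (use assms(2) in \<open>cases p; simp\<close>)+
qed

lemma hcomp_in:
  assumes "superspace sc S G" and "x \<in> S"
  shows "hcomp G p x \<in> G p" and "x - hcomp G p x \<in> G (p + 1)"
proof -
  obtain x0 x1 where x: "x0 \<in> G 0" "x1 \<in> G 1" "x = x0 + x1"
    using assms by (auto simp: superspace_def)
  define y where "y = (if p = 0 then x0 else x1)"
  have y: "y \<in> G p" "x - y \<in> G (p + 1)"
    using x by (cases p; simp add: y_def)+
  then show "hcomp G p x \<in> G p" "x - hcomp G p x \<in> G (p + 1)"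
    using hcomp_eqI[OF assms(1) y] by simp_all
qed

lemma hext_homogeneous:
  assumes "superspace sc S G" and "x \<in> G p" and "f (p + 1) 0 = 0"
  shows "hext G f x = f p x"
  using hcomp_homogeneous[OF assms(1,2)] assms(3)
  by (cases p) (auto simp: hext_def)

lemma superspace_ops:
  assumes "superspace sc UNIV V"
  shows "superspace (op_scale sc) (ops sc) (ops_gr sc V)"
proof -
  interpret vector_space sc using assms by (simp add: superspace_def)
  have sub: "subspace (V q)" for q using assms by (simp add: superspace_def)
  have int: "V 0 \<inter> V 1 = {0}" using assms by (simp add: superspace_def)
  have dec: "\<exists>y z. y \<in> V 0 \<and> z \<in> V 1 \<and> x = y + z" for x
  proof -
    have "x \<in> {x + y | x y. x \<in> V 0 \<and> y \<in> V 1}"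
      using assms by (auto simp: superspace_def)
    then show ?thesis by blast
  qed
  have int': "z = 0" if "z \<in> V p" "z \<in> V (p + 1)" for z p
    using int that by (cases p) auto
  have vs: "vector_space (op_scale sc)"
    by unfold_locales
      (auto simp: op_scale_def fun_eq_iff scale_right_distrib scale_left_distrib)
  interpret O: vector_space "op_scale sc" by (rule vs)
  have subO: "O.subspace (ops sc)"
    by (auto simp: O.subspace_def ops_def bilinear_op_def op_scale_def
        scale_right_distrib scale_left_distrib algebra_simps)
  have subG: "O.subspace (ops_gr sc V p)" for p
    using subO sub
    by (auto simp: O.subspace_def ops_gr_def has_parity_def subspace_def op_scale_def)
  define \<pi> where "\<pi> = hcomp V"
  have pi1: "\<pi> p x \<in> V p" "x - \<pi> p x \<in> V (p + 1)" for p x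
    using hcomp_in[OF assms] by (simp_all add: \<pi>_def)
  have pi2: "\<pi> 1 x = x - \<pi> 0 x" for x
    unfolding \<pi>_def using pi1[where p = 0]
    by (intro hcomp_eqI[OF assms]) (simp_all add: \<pi>_def)
  have pi3: "\<pi> p (x + y) = \<pi> p x + \<pi> p y" for p x y
  proof -
    have "(x - \<pi> p x) + (y - \<pi> p y) \<in> V (p + 1)" using pi1(2) subspace_add[OF sub] by blast
    then show ?thesis
      unfolding \<pi>_def using pi1(1) subspace_add[OF sub]
      by (intro hcomp_eqI[OF assms]) (simp_all add: \<pi>_def algebra_simps)
  qed
  have pi4: "\<pi> p (sc c x) = sc c (\<pi> p x)" for p c x
  proof -
    have "sc c (x - \<pi> p x) \<in> V (p + 1)" using pi1(2) subspace_scale[OF sub] by blast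
    then show ?thesis
      unfolding \<pi>_def using pi1(1) subspace_scale[OF sub]
      by (intro hcomp_eqI[OF assms]) (simp_all add: \<pi>_def algebra_simps)
  qed
  note pi5 = hcomp_homogeneous[OF assms, folded \<pi>_def]
  have decO: "\<exists>C D. C \<in> ops_gr sc V 0 \<and> D \<in> ops_gr sc V 1 \<and> B = C + D" if "B \<in> ops sc" for B
  proof -
    have Bl: "B (x + x') y = B x y + B x' y" "B y (x + x') = B y x + B y x'"
      "B (sc c x) y = sc c (B x y)" "B x (sc c y) = sc c (B x y)" for x x' y c
      using that by (auto simp: ops_def bilinear_op_def)
    define C where "C p x y = \<pi> p (B (\<pi> 0 x) (\<pi> 0 y)) + \<pi> (1 + p) (B (\<pi> 0 x) (\<pi> 1 y)) +
      \<pi> (1 + p) (B (\<pi> 1 x) (\<pi> 0 y)) + \<pi> p (B (\<pi> 1 x) (\<pi> 1 y))" for p x y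
    have z: "B 0 y = 0" "B y 0 = 0" for y using Bl(1)[of 0 0 y] Bl(2)[of y 0 0] by auto
    have zp: "\<pi> p 0 = 0" for p using pi3[of p 0 0] by simp
    have p01: "x \<in> V 0 \<Longrightarrow> \<pi> 0 x = x" "x \<in> V 0 \<Longrightarrow> \<pi> 1 x = 0"
      "x \<in> V 1 \<Longrightarrow> \<pi> 1 x = x" "x \<in> V 1 \<Longrightarrow> \<pi> 0 x = 0" for x
      using pi5[of x 0] pi5[of x 1] by simp_all
    have cb: "C p \<in> ops sc" for p
      unfolding ops_def bilinear_op_def C_def
      by (auto simp: Bl pi3 pi4 scale_right_distrib add.assoc add.left_commute add.commute)
    have ch: "has_parity V p (C p)" for p
      unfolding has_parity_def
    proof (intro allI ballI)
      fix i j x y assume x: "x \<in> V i" and y: "y \<in> V j"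
      have "C p x y = \<pi> (i + j + p) (B x y)"
        using x y by (cases i; cases j) (auto simp: C_def p01 z zp)
      then show "C p x y \<in> V (i + j + p)" using pi1(1) by simp
    qed
    have "B x y = C 0 x y + C 1 x y" for x y
    proof -
      have "B x y = B (\<pi> 0 x + \<pi> 1 x) (\<pi> 0 y + \<pi> 1 y)" by (simp add: pi2)
      also have "\<dots> = B (\<pi> 0 x) (\<pi> 0 y) + B (\<pi> 0 x) (\<pi> 1 y) + B (\<pi> 1 x) (\<pi> 0 y) + B (\<pi> 1 x) (\<pi> 1 y)"
        by (simp only: Bl add.assoc add.left_commute add.commute)
      also have "\<dots> = C 0 x y + C 1 x y"
      proof -
        have "u = \<pi> 0 u + \<pi> 1 u" for u by (simp add: pi2)
        from this[of "B (\<pi> 0 x) (\<pi> 0 y)"] this[of "B (\<pi> 0 x) (\<pi> 1 y)"]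
          this[of "B (\<pi> 1 x) (\<pi> 0 y)"] this[of "B (\<pi> 1 x) (\<pi> 1 y)"]
        show ?thesis unfolding C_def by (simp add: pi2)
      qed
      finally show ?thesis .
    qed
    then have "B = C 0 + C 1" by (simp add: fun_eq_iff)
    then show ?thesis using cb ch by (auto simp: ops_gr_def)
  qed
  have "ops sc = {x + y | x y. x \<in> ops_gr sc V 0 \<and> y \<in> ops_gr sc V 1}"
  proof (intro equalityI subsetI)
    fix B assume "B \<in> ops sc" then show "B \<in> {x + y | x y. x \<in> ops_gr sc V 0 \<and> y \<in> ops_gr sc V 1}"
      using decO[of B] by blast
  next
    fix B assume "B \<in> {x + y | x y. x \<in> ops_gr sc V 0 \<and> y \<in> ops_gr sc V 1}"
    then show "B \<in> ops sc" using O.subspace_add[OF subO] by (auto simp: ops_gr_def)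
  qed
  moreover have "B = 0" if B: "B \<in> ops_gr sc V 0" "B \<in> ops_gr sc V 1" for B
  proof -
    have h: "B x y = 0" if "x \<in> V i" "y \<in> V j" for x y i j
      using B that int'[of "B x y" "i + j"] by (fastforce simp: ops_gr_def has_parity_def)
    have Bl: "B (x + x') y = B x y + B x' y" "B y (x + x') = B y x + B y x'" for x x' y
      using B by (auto simp: ops_gr_def ops_def bilinear_op_def)
    have "B x y = 0" for x y
    proof -
      obtain x0 x1 y0 y1 where "x0 \<in> V 0" "x1 \<in> V 1" "x = x0 + x1" "y0 \<in> V 0" "y1 \<in> V 1" "y = y0 + y1"
        using dec[of x] dec[of y] by blast
      then show ?thesis using h by (simp add: Bl)
    qed
    then show ?thesis by (simp add: fun_eq_iff)
  qed
  moreover have "0 \<in> ops_gr sc V p" for p using O.subspace_0[OF subG] .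
  ultimately show ?thesis
    unfolding superspace_def using vs subO subG by blast
qed

lemma tri_homogeneous:
  assumes V: "superspace sc UNIV V" and A: "A \<in> ops_gr sc V p" and B: "B \<in> ops_gr sc V q"
    and x: "x \<in> V i"
  shows "tri sc V a A B x y =
    A a (B x y) - signed (p * q) (B (A a x) y) - signed (p * (q + i)) (B x (A a y))"
proof -
  note O = superspace_ops[OF V]
  have z: "C 0 u = 0" "C u 0 = 0" if "C \<in> ops sc" for C u
  proof -
    have "C (0 + 0) u = C 0 u + C 0 u" "C u (0 + 0) = C u 0 + C u 0"
      using that unfolding ops_def bilinear_op_def by blast+
    then show "C 0 u = 0" "C u 0 = 0" by simp_all
  qed
  have AB: "A \<in> ops sc" "B \<in> ops sc" using A B by (auto simp: ops_gr_def)
  have hB: "hcomp (ops_gr sc V) r B \<in> ops sc" for r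
    using hcomp_in(1)[OF O AB(2)] by (auto simp: ops_gr_def)
  have [simp]: "signed r 0 = 0" for r by (simp add: signed_def)
  have "tri sc V a A B = hext (ops_gr sc V) (\<lambda>q B. (\<lambda>x y. hext V (\<lambda>i x.
      A a (B x y) - signed (p * q) (B (A a x) y) - signed (p * (q + i)) (B x (A a y))) x)) B"
    unfolding tri_def
    by (rule hext_homogeneous[OF O A])
      (simp add: hext_def z hB fun_eq_iff)
  also have "\<dots> = (\<lambda>x y. hext V (\<lambda>i x.
      A a (B x y) - signed (p * q) (B (A a x) y) - signed (p * (q + i)) (B x (A a y))) x)"
    by (rule hext_homogeneous[OF O B]) (simp add: hext_def z AB fun_eq_iff)
  finally have "tri sc V a A B x y = hext V (\<lambda>i x.
      A a (B x y) - signed (p * q) (B (A a x) y) - signed (p * (q + i)) (B x (A a y))) x"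
    by simp
  also have "\<dots> = A a (B x y) - signed (p * q) (B (A a x) y) - signed (p * (q + i)) (B x (A a y))"
    by (rule hext_homogeneous[OF V x]) (simp add: z AB)
  finally show ?thesis .
qed

end

theory Submission
  imports Defs
begin

text \<open>Put \<open>B\<^sub>w = B w\<close> and let linear operators act on bilinear operations by the bracket, so that
  \<open>tri A B\<close> is the action of \<open>A\<^sub>a\<close> on \<open>B\<close>. For homogeneous \<open>w\<close> let \<open>N\<^sub>w\<close> be the operation sending
  \<open>(C, D)\<close> to \<open>(-1)\<close> to the power \<open>|w| |C|\<close> times the action of \<open>C\<^sub>w\<close> on \<open>D\<close>. The super Jacobi identity and
  \<open>[B\<^sub>a, C\<^sub>w] - (tri B C)\<^sub>w = \<plusminus> C\<^sub>v\<close> with \<open>v = B a w\<close> show that bracketing \<open>N\<^sub>w\<close> with left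
  multiplication by \<open>B\<close> gives \<open>N\<^sub>v\<close>. As \<open>tri = N\<^sub>a\<close>, the double bracket of \<open>A\<close> and \<open>B\<close> is \<open>N\<^sub>u\<close> with
  \<open>u = B a (A a a)\<close>. So an even bilinear operation \<open>st\<close> is an associated multiplication as soon as
  \<open>st A B a a = - signed (|A| |B|) u\<close>, and this is immediate for both given operations.\<close>

section \<open>Sign arithmetic\<close>

lemma signed_simps [simp]:
  "signed p (0::'a::ab_group_add) = 0" "signed 0 x = x" "signed 1 x = - x"
  "signed p (- x) = - signed p x"
  "signed p (signed q x) = signed (p + q) x"
  by (cases p; cases q; simp add: signed_def)+

lemma signed_add: "signed p (x + y) = signed p x + signed p (y::'a::ab_group_add)"
  by (simp add: signed_def)

lemma signed_diff: "signed p (x - y) = signed p x - signed p (y::'a::ab_group_add)"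
  by (simp add: signed_def)

lemma signed_apply: "signed p f x = signed p (f x :: 'a::ab_group_add)"
  by (simp add: signed_def)

section \<open>Graded linear and bilinear maps on a carrier\<close>

definition linear_op :: "('f::field \<Rightarrow> 'a::ab_group_add \<Rightarrow> 'a) \<Rightarrow> 'a set \<Rightarrow> ('a \<Rightarrow> 'a) \<Rightarrow> bool" where
  "linear_op sc S X \<longleftrightarrow>
     (\<forall>x\<in>S. X x \<in> S) \<and> (\<forall>x\<in>S. \<forall>y\<in>S. X (x + y) = X x + X y) \<and>
     (\<forall>c. \<forall>x\<in>S. X (sc c x) = sc c (X x))"

definition op_parity :: "(bit \<Rightarrow> 'a set) \<Rightarrow> bit \<Rightarrow> ('a \<Rightarrow> 'a) \<Rightarrow> bool" where
  "op_parity G p X \<longleftrightarrow> (\<forall>i. \<forall>x\<in>G i. X x \<in> G (i + p))"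

text \<open>The parities \<open>p\<close> and \<open>q\<close> are arguments of \<open>F\<close>
  because the signs in a formula depend on them, so a formula is only asked to be bilinear on each
  pair \<open>G p\<close>, \<open>G q\<close>. From this \<open>hext_bilinear\<close> builds a
  bilinear operation on the whole carrier.\<close>

definition graded_bilinear ::
    "('f::field \<Rightarrow> 'a::ab_group_add \<Rightarrow> 'a) \<Rightarrow> (bit \<Rightarrow> 'a set) \<Rightarrow> bit \<Rightarrow>
     (bit \<Rightarrow> bit \<Rightarrow> 'a \<Rightarrow> 'a \<Rightarrow> 'a) \<Rightarrow> bool" where
  "graded_bilinear sc G r F \<longleftrightarrow> (\<forall>p q.
     (\<forall>x\<in>G p. \<forall>y\<in>G q. F p q x y \<in> G (p + q + r)) \<and>
     (\<forall>x\<in>G p. \<forall>x'\<in>G p. \<forall>y\<in>G q. F p q (x + x') y = F p q x y + F p q x' y) \<and>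
     (\<forall>x\<in>G p. \<forall>y\<in>G q. \<forall>y'\<in>G q. F p q x (y + y') = F p q x y + F p q x y') \<and>
     (\<forall>c. \<forall>x\<in>G p. \<forall>y\<in>G q.
        F p q (sc c x) y = sc c (F p q x y) \<and> F p q x (sc c y) = sc c (F p q x y)))"

section \<open>Homogeneous components in a superspace\<close>

text \<open>The carrier \<open>S\<close> is kept general because the locale is used twice: for
  \<open>V\<close>, with carrier \<open>UNIV\<close>, and for the bilinear operations on
  \<open>V\<close>, with carrier \<open>ops sc\<close>.\<close>

locale graded_space =
  fixes sc :: "'f::field \<Rightarrow> 'a::ab_group_add \<Rightarrow> 'a" and S :: "'a set" and G :: "bit \<Rightarrow> 'a set"
  assumes ss: "superspace sc S G"
begin

sublocale vector_space sc
  using ss by (simp add: superspace_def)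

lemma subspace_carrier: "subspace S" and subspace_part: "subspace (G p)"
  using ss unfolding superspace_def by blast+

lemma part_subset: "x \<in> G p \<Longrightarrow> x \<in> S"
proof -
  assume x: "x \<in> G p"
  have "x \<in> {x + y | x y. x \<in> G 0 \<and> y \<in> G 1}"
  proof (cases "p = 0")
    case True
    then have "x = x + 0 \<and> x \<in> G 0 \<and> 0 \<in> G 1" using x subspace_0[OF subspace_part] by simp
    then show ?thesis by blast
  next
    case False
    then have "x = 0 + x \<and> 0 \<in> G 0 \<and> x \<in> G 1" using x subspace_0[OF subspace_part] by (cases p) simp_all
    then show ?thesis by blast
  qed
  then show "x \<in> S" using ss unfolding superspace_def by blast
qed

lemmas closed_S = subspace_add[OF subspace_carrier] subspace_diff[OF subspace_carrier]
  subspace_neg[OF subspace_carrier] subspace_scale[OF subspace_carrier] subspace_0[OF subspace_carrier]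

lemmas closed_G = subspace_add[OF subspace_part] subspace_diff[OF subspace_part]
  subspace_neg[OF subspace_part] subspace_scale[OF subspace_part] subspace_0[OF subspace_part]

lemma signed_S: "x \<in> S \<Longrightarrow> signed p x \<in> S"
  by (simp add: signed_def closed_S)

lemma signed_G: "x \<in> G q \<Longrightarrow> signed p x \<in> G q"
  by (simp add: signed_def closed_G)

lemma scale_signed: "sc c (signed p x) = signed p (sc c x)"
  by (simp add: signed_def scale_minus_right)

lemma comp_G: "x \<in> S \<Longrightarrow> hcomp G p x \<in> G p"
  using hcomp_in(1)[OF ss] .

lemma comp_S: "x \<in> S \<Longrightarrow> hcomp G p x \<in> S"
  using comp_G part_subset by blast

text \<open>By uniqueness of components: \<open>hcomp G p x + hcomp G p y\<close> lies in
  \<open>G p\<close>, and the sum of the two remainders lies in \<open>G (p + 1)\<close>.\<close>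

lemma comp_add:
  assumes "x \<in> S" "y \<in> S"
  shows "hcomp G p (x + y) = hcomp G p x + hcomp G p y"
proof -
  have "(x - hcomp G p x) + (y - hcomp G p y) \<in> G (p + 1)"
    by (rule closed_G(1)[OF hcomp_in(2)[OF ss assms(1)] hcomp_in(2)[OF ss assms(2)]])
  then show ?thesis
    unfolding add_diff_add[symmetric]
    by (rule hcomp_eqI[OF ss closed_G(1)[OF comp_G[OF assms(1)] comp_G[OF assms(2)]]])
qed

lemma comp_scale:
  assumes "x \<in> S"
  shows "hcomp G p (sc c x) = sc c (hcomp G p x)"
proof -
  have "sc c (x - hcomp G p x) \<in> G (p + 1)"
    by (rule closed_G(4)[OF hcomp_in(2)[OF ss assms]])
  then show ?thesis
    unfolding scale_right_diff_distrib
    by (rule hcomp_eqI[OF ss closed_G(4)[OF comp_G[OF assms]]])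
qed

lemma comp_sum:
  assumes "x \<in> S"
  shows "x = hcomp G 0 x + hcomp G 1 x"
proof -
  have "hcomp G 1 x = x - hcomp G 0 x"
    using hcomp_in[OF ss assms, of 0] by (intro hcomp_eqI[OF ss]) simp_all
  then show ?thesis by simp
qed

lemma bilinear_op_zero:
  assumes "bilinear_op sc S B" "x \<in> S"
  shows "B 0 x = 0" "B x 0 = 0"
proof -
  have "B (0 + 0) x = B 0 x + B 0 x" "B x (0 + 0) = B x 0 + B x 0"
    using assms closed_S(5) unfolding bilinear_op_def by blast+
  then show "B 0 x = 0" "B x 0 = 0" by simp_all
qed

lemma linear_op_zero:
  assumes "linear_op sc S X"
  shows "X 0 = 0"
proof -
  have "X (0 + 0) = X 0 + X 0"
    using assms closed_S(5) unfolding linear_op_def by blast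
  then show ?thesis by simp
qed

lemma linear_op_simps:
  assumes "linear_op sc S X" "x \<in> S" "y \<in> S"
  shows "X (x - y) = X x - X y" "X (- x) = - X x" "X (signed p x) = signed p (X x)"
proof -
  have m: "X (- z) = - X z" if "z \<in> S" for z
  proof -
    \<comment> \<open>Only addition and scaling are built into \<open>linear_op\<close>, so negation
      is obtained as scaling by -1.\<close>
    have "X (sc (- 1) z) = sc (- 1) (X z)" using assms(1) that unfolding linear_op_def by blast
    then show ?thesis by simp
  qed
  have "X (x + - y) = X x + X (- y)"
    using assms closed_S(3) unfolding linear_op_def by blast
  then show "X (x - y) = X x - X y" using m[OF assms(3)] by simp
  show "X (- x) = - X x" using m[OF assms(2)] .
  then show "X (signed p x) = signed p (X x)" by (simp add: signed_def)
qed

section \<open>Extension from homogeneous elements\<close>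

text \<open>Splitting each argument into its even and odd component turns a value into four values
  at homogeneous arguments. This reduces identities with signs to homogeneous elements.\<close>

lemma bilinear_op_ext:
  assumes B: "bilinear_op sc S B" and C: "bilinear_op sc S C"
    and eq: "\<And>p q x y. x \<in> G p \<Longrightarrow> y \<in> G q \<Longrightarrow> B x y = C x y"
    and x: "x \<in> S" and y: "y \<in> S"
  shows "B x y = C x y"
proof -
  have split: "D x y = D (hcomp G 0 x) (hcomp G 0 y) + D (hcomp G 0 x) (hcomp G 1 y) +
      (D (hcomp G 1 x) (hcomp G 0 y) + D (hcomp G 1 x) (hcomp G 1 y))"
    if "bilinear_op sc S D" for D
  proof -
    have "D x y = D (hcomp G 0 x + hcomp G 1 x) (hcomp G 0 y + hcomp G 1 y)"
      by (simp flip: comp_sum[OF x] comp_sum[OF y])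
    then show ?thesis
      using that comp_S[OF x] comp_S[OF y] by (simp add: bilinear_op_def closed_S)
  qed
  show ?thesis
    unfolding split[OF B] split[OF C] by (simp add: eq[OF comp_G[OF x] comp_G[OF y]])
qed

text \<open>Taking components is linear, so its composition with a formula that is bilinear on each
  pair of parts is bilinear. At homogeneous arguments three of the four terms vanish, because the
  formula is 0 when one argument is 0.\<close>

lemma hext_bilinear:
  assumes F: "graded_bilinear sc G r F"
  defines "H \<equiv> \<lambda>x y. hext G (\<lambda>p x. hext G (\<lambda>q y. F p q x y) y) x"
  shows "bilinear_op sc S H"
    and "has_parity G r H"
    and "x \<in> G p \<Longrightarrow> y \<in> G q \<Longrightarrow> H x y = F p q x y"
proof -
  have F1: "x \<in> G p \<Longrightarrow> y \<in> G q \<Longrightarrow> F p q x y \<in> G (p + q + r)"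
    "x \<in> G p \<Longrightarrow> x' \<in> G p \<Longrightarrow> y \<in> G q \<Longrightarrow> F p q (x + x') y = F p q x y + F p q x' y"
    "x \<in> G p \<Longrightarrow> y \<in> G q \<Longrightarrow> y' \<in> G q \<Longrightarrow> F p q x (y + y') = F p q x y + F p q x y'"
    "x \<in> G p \<Longrightarrow> y \<in> G q \<Longrightarrow> F p q (sc c x) y = sc c (F p q x y)"
    "x \<in> G p \<Longrightarrow> y \<in> G q \<Longrightarrow> F p q x (sc c y) = sc c (F p q x y)"
    for p q x x' y y' c
    using F unfolding graded_bilinear_def by blast+
  have F0: "y \<in> G q \<Longrightarrow> F p q 0 y = 0" "x \<in> G p \<Longrightarrow> F p q x 0 = 0" for p q x y
    using F1(2)[of 0 p 0 y q] F1(3)[of x p 0 q 0] closed_G(5) by auto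
  have FS: "F p q (hcomp G p x) (hcomp G q y) \<in> S" if "x \<in> S" "y \<in> S" for p q x y
    using F1(1) that comp_G part_subset by blast
  show "bilinear_op sc S H"
    unfolding bilinear_op_def H_def hext_def
    by (auto simp: comp_add comp_scale F1 F0 FS closed_S comp_G scale_right_distrib
        add.assoc add.left_commute)
  show ev: "H x y = F p q x y" if x: "x \<in> G p" and y: "y \<in> G q" for p q x y
  proof -
    \<comment> \<open>The outer extension is resolved first; its side condition is that the inner
      extension vanishes for first argument 0, which \<open>F0\<close> gives on both components of
      \<open>y\<close>.\<close>
    have "H x y = hext G (\<lambda>q y. F p q x y) y"
      unfolding H_def using comp_G[OF part_subset[OF y]]
      by (intro hext_homogeneous[OF ss x]) (simp add: hext_def F0)
    also have "\<dots> = F p q x y"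
      by (intro hext_homogeneous[OF ss y] F0 x)
    finally show ?thesis .
  qed
  show "has_parity G r H"
    unfolding has_parity_def by (intro allI ballI) (simp only: ev F1(1))
qed

section \<open>The bracket of a linear operator with a bilinear operation\<close>

text \<open>Of the two arguments only \<open>x\<close> contributes its parity to the signs, so
  \<open>y\<close> ranges over the whole carrier. The formula vanishes at \<open>x = 0\<close>, as
  \<open>hext_homogeneous\<close> requires.\<close>

lemma bracket_homogeneous:
  assumes "linear_op sc S X" "bilinear_op sc S B" "x \<in> G i" "y \<in> S"
  shows "bracket G p q X B x y =
    X (B x y) - signed (p * q) (B (X x) y) - signed (p * (q + i)) (B x (X y))"
proof -
  have "X y \<in> S" using assms by (simp add: linear_op_def)
  then show ?thesis
    unfolding bracket_def using assms
    by (intro hext_homogeneous[OF ss]) (simp_all add: bilinear_op_zero linear_op_zero)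
qed

lemma bracket_bilinear:
  assumes X: "linear_op sc S X" and B: "bilinear_op sc S B"
  shows "bilinear_op sc S (bracket G p q X B)"
proof -
  have X': "X x \<in> S" "X (x + y) = X x + X y" "X (sc c x) = sc c (X x)"
    if "x \<in> S" "y \<in> S" for x y c
    using X that by (auto simp: linear_op_def)
  have B': "B x y \<in> S" "B (x + x') y = B x y + B x' y" "B y (x + x') = B y x + B y x'"
    "B (sc c x) y = sc c (B x y)" "B y (sc c x) = sc c (B y x)"
    if "x \<in> S" "x' \<in> S" "y \<in> S" for x x' y c
    using B that by (auto simp: bilinear_op_def)
  show ?thesis
    unfolding bilinear_op_def bracket_def hext_def
    by (auto simp: X' B' comp_S comp_add comp_scale closed_S signed_S signed_add scale_signed
        scale_right_distrib scale_right_diff_distrib algebra_simps)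
qed

text \<open>Each of the three terms applies \<open>X\<close> once and \<open>B\<close> once, so its
  parity is \<open>i + j + p + q\<close> in whichever order they come.\<close>

lemma bracket_parity:
  assumes X: "linear_op sc S X" "op_parity G p X" and B: "bilinear_op sc S B" "has_parity G q B"
  shows "has_parity G (p + q) (bracket G p q X B)"
  unfolding has_parity_def
proof (intro allI ballI)
  fix i j x y assume x: "x \<in> G i" and y: "y \<in> G j"
  have "X (B x y) \<in> G (i + j + q + p)" "B (X x) y \<in> G ((i + p) + j + q)" "B x (X y) \<in> G (i + (j + p) + q)"
    using X(2) B(2) x y unfolding op_parity_def has_parity_def by blast+
  then show "bracket G p q X B x y \<in> G (i + j + (p + q))"
    unfolding bracket_homogeneous[OF X(1) B(1) x part_subset[OF y]]
    by (intro closed_G signed_G) (simp_all only: ac_simps)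
qed

end

section \<open>The superspace of operations and its product\<close>

locale pointed_superspace = graded_space sc UNIV V
  for sc :: "'f::field \<Rightarrow> 'v::ab_group_add \<Rightarrow> 'v" and V :: "bit \<Rightarrow> 'v set" +
  fixes a :: 'v
  assumes even: "a \<in> V 0"
begin

text \<open>Operations on \<open>V\<close> now play the role of vectors: facts prefixed with
  \<open>O\<close> concern the superspace \<open>ops sc\<close>, the unprefixed ones concern
  \<open>V\<close> itself.\<close>

sublocale O: graded_space "op_scale sc" "ops sc" "ops_gr sc V"
  by unfold_locales (rule superspace_ops[OF ss])

lemma ops_linear: "B \<in> ops sc \<Longrightarrow> linear_op sc UNIV (B x)"
  by (simp add: ops_def bilinear_op_def linear_op_def)

lemma ops_parity: "B \<in> ops_gr sc V q \<Longrightarrow> x \<in> V i \<Longrightarrow> op_parity V (i + q) (B x)"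
  unfolding ops_gr_def has_parity_def op_parity_def mem_Collect_eq
  by (metis add.commute add.left_commute)

lemma parity_value: "B \<in> ops_gr sc V q \<Longrightarrow> x \<in> V i \<Longrightarrow> y \<in> V j \<Longrightarrow> B x y \<in> V (i + j + q)"
  by (auto simp: ops_gr_def has_parity_def)

lemma ops_simps:
  assumes "B \<in> ops sc"
  shows "B (x + y) z = B x z + B y z" "B z (x + y) = B z x + B z y"
    "B (x - y) z = B x z - B y z" "B z (x - y) = B z x - B z y"
    "B (- x) z = - B x z" "B z (- x) = - B z x"
    "B (signed p x) z = signed p (B x z)" "B z (signed p x) = signed p (B z x)"
    "B (sc c x) z = sc c (B x z)" "B z (sc c x) = sc c (B z x)"
proof -
  have "linear_op sc UNIV (\<lambda>x. B x z)" "linear_op sc UNIV (B z)"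
    using assms by (simp_all add: ops_def bilinear_op_def linear_op_def)
  from linear_op_simps[OF this(1)] linear_op_simps[OF this(2)]
  show "B (x - y) z = B x z - B y z" "B z (x - y) = B z x - B z y"
    "B (- x) z = - B x z" "B z (- x) = - B z x"
    "B (signed p x) z = signed p (B x z)" "B z (signed p x) = signed p (B z x)" by simp_all
qed (use assms in \<open>simp_all add: ops_def bilinear_op_def\<close>)

lemma bracket_ops:
  assumes "linear_op sc UNIV X" "op_parity V p X" "B \<in> ops_gr sc V q"
  shows "bracket V p q X B \<in> ops_gr sc V (p + q)"
  using assms bracket_bilinear[of X B] bracket_parity[of X p B q] by (auto simp: ops_gr_def ops_def)

lemma bracket_act_ops:
  "A \<in> ops_gr sc V p \<Longrightarrow> w \<in> V i \<Longrightarrow> B \<in> ops_gr sc V q \<Longrightarrow>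
    bracket V (i + p) q (A w) B \<in> ops_gr sc V (i + p + q)"
  using ops_linear O.part_subset ops_parity by (intro bracket_ops) blast+

text \<open>As \<open>a\<close> is even, \<open>A a\<close> is a linear operator of the parity of
  \<open>A\<close>, and the bracket adds parities. For fixed parities the bracket is linear in the
  operator and in the operation.\<close>

lemma tri_graded:
  "graded_bilinear (op_scale sc) (ops_gr sc V) 0 (\<lambda>p q A B. bracket V p q (A a) B)"
  unfolding graded_bilinear_def
proof (intro allI conjI ballI)
  fix p q A B assume "A \<in> ops_gr sc V p" "B \<in> ops_gr sc V q"
  then show "bracket V p q (A a) B \<in> ops_gr sc V (p + q + 0)"
    using bracket_act_ops[OF _ even] by (simp only: add_0_left add_0_right)
next
  fix p q A A' B assume "A \<in> ops_gr sc V p" "A' \<in> ops_gr sc V p" "B \<in> ops_gr sc V q"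
  then have "A \<in> ops sc" "A' \<in> ops sc" "B \<in> ops sc" using O.part_subset by blast+
  then show "bracket V p q ((A + A') a) B = bracket V p q (A a) B + bracket V p q (A' a) B"
    by (simp add: fun_eq_iff bracket_def hext_def ops_simps signed_add signed_diff algebra_simps)
next
  fix p q A B B' assume "A \<in> ops_gr sc V p" "B' \<in> ops_gr sc V q" "B \<in> ops_gr sc V q"
  then have "A \<in> ops sc" "B' \<in> ops sc" "B \<in> ops sc" using O.part_subset by blast+
  then show "bracket V p q (A a) (B + B') = bracket V p q (A a) B + bracket V p q (A a) B'"
    by (simp add: fun_eq_iff bracket_def hext_def ops_simps signed_add signed_diff algebra_simps)
next
  fix p q c A B assume "A \<in> ops_gr sc V p" "B \<in> ops_gr sc V q"
  then have "A \<in> ops sc" "B \<in> ops sc" using O.part_subset by blast+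
  then show "bracket V p q ((op_scale sc c A) a) B = op_scale sc c (bracket V p q (A a) B)"
    "bracket V p q (A a) (op_scale sc c B) = op_scale sc c (bracket V p q (A a) B)"
    by (simp_all add: fun_eq_iff bracket_def hext_def ops_simps scale_signed op_scale_def
        scale_right_distrib scale_right_diff_distrib)
qed

text \<open>Written as the extension of a bracket, \<open>tri\<close> inherits bilinearity and
  parity 0 from \<open>hext_bilinear\<close> and \<open>tri_graded\<close>.\<close>

lemma tri_hext:
  "tri sc V a = (\<lambda>A B. hext (ops_gr sc V) (\<lambda>p A. hext (ops_gr sc V) (\<lambda>q B. bracket V p q (A a) B) B) A)"
  by (simp add: fun_eq_iff tri_def bracket_def[abs_def])

lemma tri_bilinear: "bilinear_op (op_scale sc) (ops sc) (tri sc V a)"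
  and tri_parity: "has_parity (ops_gr sc V) 0 (tri sc V a)"
  and tri_eq: "A \<in> ops_gr sc V p \<Longrightarrow> B \<in> ops_gr sc V q \<Longrightarrow> tri sc V a A B = bracket V p q (A a) B"
  using O.hext_bilinear[OF tri_graded] by (simp_all only: tri_hext)

lemma tri_closed: "A \<in> ops_gr sc V p \<Longrightarrow> B \<in> ops_gr sc V q \<Longrightarrow> tri sc V a A B \<in> ops_gr sc V (p + q)"
  using tri_parity unfolding has_parity_def by (metis add.right_neutral)

lemma tri_simps:
  "A \<in> ops sc \<Longrightarrow> A' \<in> ops sc \<Longrightarrow> B \<in> ops sc \<Longrightarrow>
    tri sc V a (A + A') B = tri sc V a A B + tri sc V a A' B"
  "A \<in> ops sc \<Longrightarrow> B \<in> ops sc \<Longrightarrow> B' \<in> ops sc \<Longrightarrow>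
    tri sc V a A (B + B') = tri sc V a A B + tri sc V a A B'"
  "A \<in> ops sc \<Longrightarrow> B \<in> ops sc \<Longrightarrow> tri sc V a (op_scale sc c A) B = op_scale sc c (tri sc V a A B)"
  "A \<in> ops sc \<Longrightarrow> B \<in> ops sc \<Longrightarrow> tri sc V a A (op_scale sc c B) = op_scale sc c (tri sc V a A B)"
  using tri_bilinear unfolding bilinear_op_def by blast+

lemma tri_linear: "A \<in> ops sc \<Longrightarrow> linear_op (op_scale sc) (ops sc) (tri sc V a A)"
  using tri_bilinear by (simp add: bilinear_op_def linear_op_def)

section \<open>Evaluation actions and the Jacobi identity\<close>

text \<open>\<open>P\<close> is the operation \<open>N\<^sub>w\<close> for \<open>w\<close> of parity \<open>i\<close>.\<close>

definition evaluation_action :: "bit \<Rightarrow> 'v \<Rightarrow> (('v \<Rightarrow> 'v \<Rightarrow> 'v) \<Rightarrow> ('v \<Rightarrow> 'v \<Rightarrow> 'v) \<Rightarrow> 'v \<Rightarrow> 'v \<Rightarrow> 'v) \<Rightarrow> bool"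
  where "evaluation_action i w P \<longleftrightarrow> (\<forall>r s. \<forall>C\<in>ops_gr sc V r. \<forall>D\<in>ops_gr sc V s.
     P C D = signed (i * r) (bracket V (i + r) s (C w) D))"

lemma evaluation_action_tri: "evaluation_action 0 a (tri sc V a)"
  unfolding evaluation_action_def mult_zero_left add_0_left signed_simps using tri_eq by blast

text \<open>The iterated actions of \<open>B a\<close> and \<open>C w\<close> on \<open>D\<close>
  cancel as in the super Jacobi identity. What is left comes from the middle term of
  \<open>tri sc V a B C\<close> evaluated at \<open>w\<close>, which contains
  \<open>C (B a w)\<close>.\<close>

lemma evaluation_action_bracket:
  assumes w: "w \<in> V i" and P: "bilinear_op (op_scale sc) (ops sc) P" "evaluation_action i w P"
    and B: "B \<in> ops_gr sc V j"
  shows "evaluation_action (i + j) (B a w) (bracket (ops_gr sc V) j i (tri sc V a B) P)"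
  unfolding evaluation_action_def
proof (intro allI ballI)
  fix r s C D assume C: "C \<in> ops_gr sc V r" and D: "D \<in> ops_gr sc V s"
  note BL = ops_linear[OF O.part_subset[OF B]] and CL = ops_linear[OF O.part_subset[OF C]]
  have ops: "B \<in> ops sc" "C \<in> ops sc" "D \<in> ops sc" using B C D O.part_subset by blast+
  define E where "E = bracket V (i + r) s (C w) D"
  define C' where "C' = tri sc V a B C"
  define D' where "D' = tri sc V a B D"
  have C': "C' \<in> ops_gr sc V (j + r)" and D': "D' \<in> ops_gr sc V (j + s)"
    unfolding C'_def D'_def using tri_closed B C D by blast+
  have E: "E \<in> ops_gr sc V (i + r + s)" unfolding E_def by (rule bracket_act_ops[OF C w D])
  have Bw: "B a w \<in> V (i + j)" using parity_value[OF B even w] by simp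
  let ?L = "bracket (ops_gr sc V) j i (tri sc V a B) P C D"
  let ?R = "signed ((i + j) * r) (bracket V (i + j + r) s (C (B a w)) D)"
  have L: "?L = signed (i * r) (bracket V j (i + r + s) (B a) E)
      - signed (j * i + i * (j + r)) (bracket V (i + (j + r)) s (C' w) D)
      - signed (j * (i + r) + i * r) (bracket V (i + r) (j + s) (C w) D')"
    using P(2) C D C' D' E B
      O.linear_op_simps(3)[OF tri_linear[OF ops(1)] O.part_subset[OF E] O.part_subset[OF E]]
    by (simp only: O.bracket_homogeneous[OF tri_linear[OF ops(1)] P(1) C ops(3)]
        evaluation_action_def E_def[symmetric] C'_def[symmetric] D'_def[symmetric] tri_eq[OF B E] signed_simps)
  \<comment> \<open>The values \<open>?L\<close> and \<open>?R\<close> are operations on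
    \<open>V\<close>; once both are known to be bilinear, they can be compared at homogeneous
    arguments from \<open>V\<close>.\<close>
  have "?L \<in> ops sc"
    using O.bracket_bilinear[OF tri_linear[OF ops(1)] P(1), of j i] ops
    by (simp add: bilinear_op_def)
  moreover have "?R \<in> ops sc"
    using O.part_subset[OF bracket_act_ops[OF C Bw D]] by (rule O.signed_S)
  ultimately have bil: "bilinear_op sc UNIV ?L" "bilinear_op sc UNIV ?R"
    by (simp_all add: ops_def)
  have hom: "?L x y = ?R x y" if x: "x \<in> V k" for x y k
  proof -
    have ev: "bracket V p q X A z y = X (A z y) - signed (p * q) (A (X z) y) - signed (p * (q + l)) (A z (X y))"
      if "linear_op sc UNIV X" "A \<in> ops sc" "z \<in> V l" for p q X A z y l
      using bracket_homogeneous that by (simp add: ops_def)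
    have Bx: "B a x \<in> V (k + j)" and Cx: "C w x \<in> V (i + k + r)"
      using parity_value[OF B even x] parity_value[OF C w x] by simp_all
    have E_ops: "E \<in> ops sc" "D' \<in> ops sc" using E D' O.part_subset by blast+
    have C'w: "C' w z = B a (C w z) - signed (j * r) (C (B a w) z) - signed (j * (r + i)) (C w (B a z))" for z
      unfolding C'_def tri_eq[OF B C] by (rule ev[OF BL ops(2) w])
    have D'x: "D' z y = B a (D z y) - signed (j * s) (D (B a z) y) - signed (j * (s + l)) (D z (B a y))"
      if "z \<in> V l" for z y l
      unfolding D'_def tri_eq[OF B D] by (rule ev[OF BL ops(3) that])
    have Ex: "E z y = C w (D z y) - signed ((i + r) * s) (D (C w z) y) - signed ((i + r) * (s + l)) (D z (C w y))"
      if "z \<in> V l" for z y l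
      unfolding E_def by (rule ev[OF CL ops(3) that])
    have e1: "bracket V j (i + r + s) (B a) E x y = B a (E x y)
        - signed (j * (i + r + s)) (E (B a x) y) - signed (j * (i + r + s + k)) (E x (B a y))"
      by (rule ev[OF BL E_ops(1) x])
    have e2: "bracket V (i + (j + r)) s (C' w) D x y = C' w (D x y)
        - signed ((i + (j + r)) * s) (D (C' w x) y) - signed ((i + (j + r)) * (s + k)) (D x (C' w y))"
      by (rule ev[OF ops_linear[OF O.part_subset[OF C']] ops(3) x])
    have e3: "bracket V (i + r) (j + s) (C w) D' x y = C w (D' x y)
        - signed ((i + r) * (j + s)) (D' (C w x) y) - signed ((i + r) * (j + s + k)) (D' x (C w y))"
      by (rule ev[OF CL E_ops(2) x])
    have e4: "bracket V (i + j + r) s (C (B a w)) D x y = C (B a w) (D x y)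
        - signed ((i + j + r) * s) (D (C (B a w) x) y) - signed ((i + j + r) * (s + k)) (D x (C (B a w) y))"
      by (rule ev[OF CL ops(3) x])
    \<comment> \<open>After unfolding, both sides are sums of compositions of \<open>B\<close>,
      \<open>C\<close> and \<open>D\<close> with signs that depend only on the five parities. In
      each of the 32 cases additivity makes the terms agree.\<close>
    show ?thesis
      unfolding L minus_apply signed_apply e1 e2 e3 e4 C'w D'x[OF x] D'x[OF Cx] Ex[OF x] Ex[OF Bx]
      by (cases i; cases j; cases r; cases s; cases k; simp add: ops_simps[OF ops(1)]
          ops_simps[OF ops(2)] ops_simps[OF ops(3)])
  qed
  show "?L = ?R"
  proof (intro ext)
    fix x y show "?L x y = ?R x y"
      using hom bilinear_op_ext[OF bil] by blast
  qed
qed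

text \<open>This carries a sign from the vector of an evaluation action to its value.\<close>

lemma bracket_signed_left:
  assumes "C \<in> ops sc" "D \<in> ops sc"
  shows "bracket V p q (C (signed t w)) D = signed t (bracket V p q (C w) D)"
  by (cases t) (simp_all add: fun_eq_iff bracket_def hext_def ops_simps[OF assms(1)] ops_simps[OF assms(2)])

text \<open>Starting from \<open>a\<close>, two uses of \<open>evaluation_action_bracket\<close>
  show that the double bracket is the evaluation action of \<open>B a (A a a)\<close>; one use shows
  that the bracket for \<open>st A B\<close> is that of \<open>st A B a a\<close>. On homogeneous
  arguments an evaluation action is determined by its parity and its vector, so it is enough that
  \<open>diag\<close> compares the two vectors.\<close>

lemma associated_multI:
  assumes st: "bilinear_op (op_scale sc) (ops sc) st" "has_parity (ops_gr sc V) 0 st"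
    and diag: "\<And>i j A B. A \<in> ops_gr sc V i \<Longrightarrow> B \<in> ops_gr sc V j \<Longrightarrow>
      st A B a a = - signed (i * j) (B a (A a a))"
  shows "associated_mult (op_scale sc) (ops sc) (ops_gr sc V) (tri sc V a) st"
  unfolding associated_mult_def
proof (intro conjI allI ballI st)
  fix i j A B C D
  assume A: "A \<in> ops_gr sc V i" and B: "B \<in> ops_gr sc V j" and C: "C \<in> ops sc" and D: "D \<in> ops sc"
  let ?b = "bracket (ops_gr sc V)" and ?T = "tri sc V a"
  let ?w = "B a (A a a)"
  have AB: "st A B \<in> ops_gr sc V (i + j)"
    using st(2) A B unfolding has_parity_def by (metis add.right_neutral)
  have ops: "A \<in> ops sc" "B \<in> ops sc" "st A B \<in> ops sc"
    using A B AB O.part_subset by blast+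
  have w: "A a a \<in> V i" using parity_value[OF A even even] by (simp only: add_0_left)
  \<comment> \<open>The minus sign is written as an extra summand 1 of the parity, so that
    \<open>bracket_signed_left\<close> can take out the whole sign at once.\<close>
  have w': "st A B a a = signed (i * j + 1) ?w"
    unfolding diag[OF A B] by (cases i; cases j; simp)
  have Q: "evaluation_action i (A a a) (?b i 0 (?T A) ?T)"
    using evaluation_action_bracket[OF even tri_bilinear evaluation_action_tri A]
    by (simp only: add_0_left)
  note Qb = O.bracket_bilinear[OF tri_linear[OF ops(1)] tri_bilinear, of i 0]
  have L: "evaluation_action (i + j) ?w (?b j i (?T B) (?b i 0 (?T A) ?T))"
    using evaluation_action_bracket[OF w Qb Q B] .
  have R: "evaluation_action (i + j) (signed (i * j + 1) ?w) (?b (i + j) 0 (?T (st A B)) ?T)"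
    using evaluation_action_bracket[OF even tri_bilinear evaluation_action_tri AB]
    by (simp only: add_0_left w')
  have Lb: "bilinear_op (op_scale sc) (ops sc) (?b j i (?T B) (?b i 0 (?T A) ?T))"
    by (rule O.bracket_bilinear[OF tri_linear[OF ops(2)] Qb])
  have Rb: "bilinear_op (op_scale sc) (ops sc) (?b (i + j) 0 (?T (st A B)) ?T)"
    by (rule O.bracket_bilinear[OF tri_linear[OF ops(3)] tri_bilinear])
  have Rb': "bilinear_op (op_scale sc) (ops sc)
      (\<lambda>C D. - signed (i * j) (?b (i + j) 0 (?T (st A B)) ?T C D))"
    using Rb unfolding bilinear_op_def
    by (simp add: signed_add O.scale_signed O.signed_S O.closed_S)
  show "?b j i (?T B) (?b i 0 (?T A) ?T) C D = - signed (i * j) (?b (i + j) 0 (?T (st A B)) ?T C D)"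
  proof (rule O.bilinear_op_ext[OF Lb Rb' _ C D])
    fix r s C D assume C: "C \<in> ops_gr sc V r" and D: "D \<in> ops_gr sc V s"
    have L': "?b j i (?T B) (?b i 0 (?T A) ?T) C D =
        signed ((i + j) * r) (bracket V (i + j + r) s (C ?w) D)"
      using L C D unfolding evaluation_action_def by blast
    have R': "?b (i + j) 0 (?T (st A B)) ?T C D =
        signed ((i + j) * r) (bracket V (i + j + r) s (C (signed (i * j + 1) ?w)) D)"
      using R C D unfolding evaluation_action_def by blast
    show "?b j i (?T B) (?b i 0 (?T A) ?T) C D = - signed (i * j) (?b (i + j) 0 (?T (st A B)) ?T C D)"
      unfolding L' R' bracket_signed_left[OF O.part_subset[OF C] O.part_subset[OF D]]
      by (cases i; cases j; cases r; simp)
  qed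
qed

section \<open>The first associated multiplication\<close>

lemma nabla1_graded:
  "graded_bilinear (op_scale sc) (ops_gr sc V) 0 (\<lambda>p q A B x y. - signed (p * q) (B a (A x y)))"
  unfolding graded_bilinear_def
proof (intro allI conjI ballI)
  fix p q A B assume A: "A \<in> ops_gr sc V p" and B: "B \<in> ops_gr sc V q"
  let ?N = "\<lambda>x y. - signed (p * q) (B a (A x y))"
  have ops: "A \<in> ops sc" "B \<in> ops sc" using A B O.part_subset by blast+
  have "?N \<in> ops sc"
    unfolding ops_def bilinear_op_def
    by (simp add: ops_simps[OF ops(1)] ops_simps[OF ops(2)] signed_add scale_signed)
  moreover have "has_parity V (p + q) ?N"
    unfolding has_parity_def
  proof (intro allI ballI)
    fix i j x y assume "x \<in> V i" "y \<in> V j"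
    \<comment> \<open>The leading summand 0 is the parity of \<open>a\<close>.\<close>
    then have "B a (A x y) \<in> V (0 + (i + j + p) + q)"
      using parity_value A B even by blast
    then show "?N x y \<in> V (i + j + (p + q))"
      by (intro closed_G(3) signed_G) (simp only: ac_simps add_0_left)
  qed
  ultimately show "?N \<in> ops_gr sc V (p + q + 0)" by (simp add: ops_gr_def)
next
  fix p q A A' B assume "B \<in> ops_gr sc V q"
  then have "B \<in> ops sc" using O.part_subset by blast
  then show "(\<lambda>x y. - signed (p * q) (B a ((A + A') x y))) =
      (\<lambda>x y. - signed (p * q) (B a (A x y))) + (\<lambda>x y. - signed (p * q) (B a (A' x y)))"
    by (simp add: fun_eq_iff ops_simps signed_add)
next
  fix p q A B B'
  show "(\<lambda>x y. - signed (p * q) ((B + B') a (A x y))) =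
      (\<lambda>x y. - signed (p * q) (B a (A x y))) + (\<lambda>x y. - signed (p * q) (B' a (A x y)))"
    by (simp add: fun_eq_iff signed_add)
next
  fix p q c A B assume "B \<in> ops_gr sc V q"
  then have "B \<in> ops sc" using O.part_subset by blast
  then show "(\<lambda>x y. - signed (p * q) (B a (op_scale sc c A x y))) =
      op_scale sc c (\<lambda>x y. - signed (p * q) (B a (A x y)))"
    by (simp add: fun_eq_iff ops_simps op_scale_def scale_signed)
  show "(\<lambda>x y. - signed (p * q) (op_scale sc c B a (A x y))) =
      op_scale sc c (\<lambda>x y. - signed (p * q) (B a (A x y)))"
    by (simp add: fun_eq_iff op_scale_def scale_signed)
qed

lemma nabla1_hext:
  "nabla1 sc V a = (\<lambda>A B. hext (ops_gr sc V) (\<lambda>p A. hext (ops_gr sc V)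
     (\<lambda>q B x y. - signed (p * q) (B a (A x y))) B) A)"
  by (simp add: fun_eq_iff nabla1_def)

text \<open>At \<open>x = y = a\<close> the defining formula of \<open>nabla1\<close> is exactly the
  condition \<open>diag\<close> of \<open>associated_multI\<close>.\<close>

lemma associated_mult_nabla1:
  "associated_mult (op_scale sc) (ops sc) (ops_gr sc V) (tri sc V a) (nabla1 sc V a)"
  using O.hext_bilinear[OF nabla1_graded] by (intro associated_multI) (simp_all only: nabla1_hext)

section \<open>The second associated multiplication\<close>

text \<open>Exchanging the two arguments leaves the parity of the value unchanged, so the formula is
  graded bilinear of the parity of \<open>A\<close> and \<open>hext_bilinear\<close>
  applies.\<close>

lemma op_star:
  assumes A: "A \<in> ops_gr sc V p"
  shows "op_star V A \<in> ops_gr sc V p"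
    and "x \<in> V i \<Longrightarrow> y \<in> V j \<Longrightarrow> op_star V A x y = A x y + signed (i * j) (A y x)"
proof -
  note AO = O.part_subset[OF A]
  have "graded_bilinear sc V p (\<lambda>i j x y. A x y + signed (i * j) (A y x))"
    unfolding graded_bilinear_def
  proof (intro allI conjI ballI)
    fix i j x y assume "x \<in> V i" "y \<in> V j"
    then have "A x y \<in> V (i + j + p)" "A y x \<in> V (i + j + p)"
      using parity_value[OF A] by (metis add.commute)+
    then show "A x y + signed (i * j) (A y x) \<in> V (i + j + p)"
      by (intro closed_G(1) signed_G)
  qed (simp_all add: ops_simps[OF AO] signed_add scale_signed scale_right_distrib)
  note H = hext_bilinear[OF this]
  have E: "op_star V A = (\<lambda>x y. hext V (\<lambda>i x. hext V (\<lambda>j y. A x y + signed (i * j) (A y x)) y) x)"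
    by (simp add: fun_eq_iff op_star_def)
  show "op_star V A \<in> ops_gr sc V p"
    using H(1,2) by (simp add: ops_gr_def ops_def E)
  show "x \<in> V i \<Longrightarrow> y \<in> V j \<Longrightarrow> op_star V A x y = A x y + signed (i * j) (A y x)"
    using H(3) by (simp only: E)
qed

lemma op_tilde:
  assumes A: "A \<in> ops_gr sc V p"
  shows "op_tilde sc V A \<in> ops_gr sc V p"
    and "x \<in> V i \<Longrightarrow> y \<in> V j \<Longrightarrow> op_tilde sc V A x y = sc 2 (signed (i * j) (A y x)) - A x y"
proof -
  note AO = O.part_subset[OF A]
  have "graded_bilinear sc V p (\<lambda>i j x y. sc 2 (signed (i * j) (A y x)) - A x y)"
    unfolding graded_bilinear_def
  proof (intro allI conjI ballI)
    fix i j x y assume "x \<in> V i" "y \<in> V j"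
    then have "A x y \<in> V (i + j + p)" "A y x \<in> V (i + j + p)"
      using parity_value[OF A] by (metis add.commute)+
    then show "sc 2 (signed (i * j) (A y x)) - A x y \<in> V (i + j + p)"
      by (intro closed_G(2,4) signed_G)
  qed (simp_all add: ops_simps[OF AO] signed_add scale_signed scale_right_distrib
      scale_right_diff_distrib mult.commute)
  note H = hext_bilinear[OF this]
  have E: "op_tilde sc V A = (\<lambda>x y. hext V (\<lambda>i x. hext V (\<lambda>j y. sc 2 (signed (i * j) (A y x)) - A x y) y) x)"
    by (simp add: fun_eq_iff op_tilde_def)
  show "op_tilde sc V A \<in> ops_gr sc V p"
    using H(1,2) by (simp add: ops_gr_def ops_def E)
  show "x \<in> V i \<Longrightarrow> y \<in> V j \<Longrightarrow> op_tilde sc V A x y = sc 2 (signed (i * j) (A y x)) - A x y"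
    using H(3) by (simp only: E)
qed

lemma op_star_linear:
  "op_star V (A + B) = op_star V A + op_star V B"
  "op_star V (op_scale sc c A) = op_scale sc c (op_star V A)"
  by (simp_all add: fun_eq_iff op_star_def hext_def signed_add scale_signed op_scale_def
      scale_right_distrib scale_right_diff_distrib ac_simps)

lemma op_tilde_add:
  "op_tilde sc V (A + B) = op_tilde sc V A + op_tilde sc V B"
  by (simp add: fun_eq_iff op_tilde_def hext_def signed_add scale_right_distrib algebra_simps)

lemma op_tilde_scale:
  "op_tilde sc V (op_scale sc c A) = op_scale sc c (op_tilde sc V A)"
  by (simp add: fun_eq_iff op_tilde_def hext_def signed_add scale_signed op_scale_def
      scale_right_distrib scale_right_diff_distrib mult.commute)

text \<open>Both \<open>op_star\<close> and \<open>op_tilde\<close> preserve parity and are linear,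
  so the two products have parity \<open>p + q\<close> and depend bilinearly on \<open>A\<close> and
  \<open>B\<close>.\<close>

lemma nabla2_graded:
  "graded_bilinear (op_scale sc) (ops_gr sc V) 0 (\<lambda>p q A B. op_scale sc (1 / 3)
     (tri sc V a (op_star V A) B + signed (p * q) (tri sc V a (op_tilde sc V B) A)))"
  unfolding graded_bilinear_def
proof (intro allI conjI ballI)
  fix p q A B assume A: "A \<in> ops_gr sc V p" and B: "B \<in> ops_gr sc V q"
  have "tri sc V a (op_star V A) B \<in> ops_gr sc V (p + q)"
    by (rule tri_closed[OF op_star(1)[OF A] B])
  moreover have "tri sc V a (op_tilde sc V B) A \<in> ops_gr sc V (p + q)"
    unfolding add.commute[of p] by (rule tri_closed[OF op_tilde(1)[OF B] A])
  ultimately show "op_scale sc (1 / 3) (tri sc V a (op_star V A) B +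
      signed (p * q) (tri sc V a (op_tilde sc V B) A)) \<in> ops_gr sc V (p + q + 0)"
    unfolding add_0_right by (intro O.closed_G(1,4) O.signed_G)
next
  fix p q A A' B assume "A \<in> ops_gr sc V p" "A' \<in> ops_gr sc V p" "B \<in> ops_gr sc V q"
  note ops = this[THEN O.part_subset] this[THEN op_star(1), THEN O.part_subset]
    this[THEN op_tilde(1), THEN O.part_subset]
  show "op_scale sc (1 / 3) (tri sc V a (op_star V (A + A')) B +
      signed (p * q) (tri sc V a (op_tilde sc V B) (A + A'))) =
    op_scale sc (1 / 3) (tri sc V a (op_star V A) B + signed (p * q) (tri sc V a (op_tilde sc V B) A)) +
    op_scale sc (1 / 3) (tri sc V a (op_star V A') B + signed (p * q) (tri sc V a (op_tilde sc V B) A'))"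
    unfolding op_star_linear using ops
    by (simp only: tri_simps signed_add O.scale_right_distrib ac_simps)
next
  fix p q A B B' assume "A \<in> ops_gr sc V p" "B \<in> ops_gr sc V q" "B' \<in> ops_gr sc V q"
  note ops = this[THEN O.part_subset] this[THEN op_star(1), THEN O.part_subset]
    this[THEN op_tilde(1), THEN O.part_subset]
  show "op_scale sc (1 / 3) (tri sc V a (op_star V A) (B + B') +
      signed (p * q) (tri sc V a (op_tilde sc V (B + B')) A)) =
    op_scale sc (1 / 3) (tri sc V a (op_star V A) B + signed (p * q) (tri sc V a (op_tilde sc V B) A)) +
    op_scale sc (1 / 3) (tri sc V a (op_star V A) B' + signed (p * q) (tri sc V a (op_tilde sc V B') A))"
    unfolding op_tilde_add using ops
    by (simp only: tri_simps signed_add O.scale_right_distrib ac_simps)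
next
  fix p q c A B assume "A \<in> ops_gr sc V p" "B \<in> ops_gr sc V q"
  note ops = this[THEN O.part_subset] this[THEN op_star(1), THEN O.part_subset]
    this[THEN op_tilde(1), THEN O.part_subset]
  show "op_scale sc (1 / 3) (tri sc V a (op_star V (op_scale sc c A)) B +
      signed (p * q) (tri sc V a (op_tilde sc V B) (op_scale sc c A))) =
    op_scale sc c (op_scale sc (1 / 3) (tri sc V a (op_star V A) B +
      signed (p * q) (tri sc V a (op_tilde sc V B) A)))"
    unfolding op_star_linear using ops
    by (simp only: tri_simps O.scale_signed[symmetric] O.scale_right_distrib O.scale_scale mult.commute)
  show "op_scale sc (1 / 3) (tri sc V a (op_star V A) (op_scale sc c B) +
      signed (p * q) (tri sc V a (op_tilde sc V (op_scale sc c B)) A)) =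
    op_scale sc c (op_scale sc (1 / 3) (tri sc V a (op_star V A) B +
      signed (p * q) (tri sc V a (op_tilde sc V B) A)))"
    unfolding op_tilde_scale using ops
    by (simp only: tri_simps O.scale_signed[symmetric] O.scale_right_distrib O.scale_scale mult.commute)
qed

lemma nabla2_hext:
  "nabla2 sc V a = (\<lambda>A B. hext (ops_gr sc V) (\<lambda>p A. hext (ops_gr sc V) (\<lambda>q B.
     op_scale sc (1 / 3) (tri sc V a (op_star V A) B +
       signed (p * q) (tri sc V a (op_tilde sc V B) A))) B) A)"
  by (simp add: fun_eq_iff nabla2_def)

text \<open>At \<open>a\<close> the signs inside \<open>op_star\<close> and \<open>op_tilde\<close>
  disappear, since \<open>a\<close> is even. The coefficients 2 and -1 in \<open>op_tilde\<close>
  have sum 1, which makes the terms with \<open>A\<close> outermost cancel; the 2 cancels the two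
  copies of \<open>B (A a a) a\<close>, which arise because \<open>op_star V A a a\<close> is twice
  \<open>A a a\<close>. Three copies of \<open>B a (A a a)\<close> with a common sign remain, hence
  the factor one third.\<close>

lemma associated_mult_nabla2:
  assumes three: "(3::'f) \<noteq> 0"
  shows "associated_mult (op_scale sc) (ops sc) (ops_gr sc V) (tri sc V a) (nabla2 sc V a)"
proof (rule associated_multI)
  fix i j A B assume A: "A \<in> ops_gr sc V i" and B: "B \<in> ops_gr sc V j"
  have ops: "A \<in> ops sc" "B \<in> ops sc" using A B O.part_subset by blast+
  have p: "A a a \<in> V i" "B a a \<in> V j"
    using parity_value[OF A even even] parity_value[OF B even even] by (simp_all only: add_0_left)
  have two: "sc 2 u = u + u" for u using scale_left_distrib[of 1 1 u] by simp
  note st = op_star(2)[OF A] and ti = op_tilde(2)[OF B]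
  let ?u = "B a (A a a)"
  have 1: "tri sc V a (op_star V A) B a a =
      A a (B a a) + A (B a a) a - signed (i * j) (B (A a a) a) - signed (i * j) (B (A a a) a)
      - signed (i * j) ?u - signed (i * j) ?u"
    unfolding tri_homogeneous[OF ss op_star(1)[OF A] B even] st[OF even even] st[OF even p(2)]
    by (simp add: ops_simps[OF ops(2)] signed_add algebra_simps)
  have 2: "tri sc V a (op_tilde sc V B) A a a =
      B (A a a) a + B (A a a) a - ?u - signed (i * j) (A (B a a) a) - signed (i * j) (A a (B a a))"
    unfolding tri_homogeneous[OF ss op_tilde(1)[OF B] A even] ti[OF even even] ti[OF even p(1)]
    by (simp add: ops_simps[OF ops(1)] two mult.commute)
  have "tri sc V a (op_star V A) B a a + signed (i * j) (tri sc V a (op_tilde sc V B) A a a) =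
      - signed (i * j) (?u + ?u + ?u)"
    unfolding 1 2 by (cases "i * j") (simp_all add: algebra_simps)
  also have "?u + ?u + ?u = sc 3 ?u"
    using scale_left_distrib[of 2 1 ?u] two[of ?u] by simp
  finally have "nabla2 sc V a A B a a = sc (1 / 3) (- signed (i * j) (sc 3 ?u))"
    using O.hext_bilinear(3)[OF nabla2_graded A B]
    by (simp add: nabla2_hext op_scale_def signed_apply)
  \<comment> \<open>The factors \<open>1 / 3\<close> and 3 cancel by \<open>three\<close>; in
    characteristic 3 the term \<open>1 / 3\<close> would denote 0.\<close>
  then show "nabla2 sc V a A B a a = - signed (i * j) ?u"
    using three by (simp add: scale_signed)
qed (use O.hext_bilinear(1,2)[OF nabla2_graded] in \<open>simp_all only: nabla2_hext\<close>)

end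

section \<open>The characteristic and the conclusion\<close>

text \<open>If 3 vanished, the characteristic would divide 3; it is not 1 in a field, so it would be
  3.\<close>

lemma three_neq_zero:
  assumes "CHAR('f::field) \<noteq> 3"
  shows "(3::'f) \<noteq> 0"
proof
  assume "(3::'f) = 0"
  then have "of_nat 3 = (0::'f)" by simp
  then have "CHAR('f) dvd 3" by (simp only: of_nat_eq_0_iff_char_dvd)
  moreover have "CHAR('f) \<noteq> 1" by (metis of_nat_CHAR of_nat_1 zero_neq_one)
  moreover have "CHAR('f) \<noteq> 0" "CHAR('f) \<noteq> 2"
    using \<open>CHAR('f) dvd 3\<close> by (intro notI; simp)+
  moreover have "CHAR('f) \<le> 3"
    using \<open>CHAR('f) dvd 3\<close> by (simp add: dvd_imp_le)
  ultimately show False using assms by linarith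
qed

theorem theorem8:
  fixes sc :: "'f::field \<Rightarrow> 'v::ab_group_add \<Rightarrow> 'v" and V :: "bit \<Rightarrow> 'v set" and a :: 'v
  assumes "superspace sc UNIV V"
    and "a \<in> V 0"
  shows "conservative (op_scale sc) (ops sc) (ops_gr sc V) (tri sc V a) \<and>
    associated_mult (op_scale sc) (ops sc) (ops_gr sc V) (tri sc V a) (nabla1 sc V a) \<and>
    (CHAR('f) \<noteq> 3 \<longrightarrow>
      associated_mult (op_scale sc) (ops sc) (ops_gr sc V) (tri sc V a) (nabla2 sc V a))"
proof -
  interpret pointed_superspace sc V a
    by unfold_locales (use assms in simp_all)
  \<comment> \<open>In every characteristic \<open>nabla1\<close> can serve as the witness for
    conservativity.\<close>
  show ?thesis
    using associated_mult_nabla1 associated_mult_nabla2 three_neq_zero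
    by (auto simp: conservative_def superalgebra_def O.ss tri_bilinear tri_parity)
qed

end
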